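(* Let $G$ be a group such that $x\otimes x=1_\otimes$ in $G\otimes G$ for all $x\in G$. Let $g\in G$ and let $T_g$ be the inner automorphism of $G$ induced by $g$, i.e. $T_g(x)=g^{-1}xg$. Then $T_g\in A^\otimes(G)$ if and only if $g\in R_2^\otimes(G)$.
   Context: Conventions: $g^h=h^{-1}gh$ and $[g,h]=g^{-1}h^{-1}gh$. For a group $G$, the non-abelian tensor square $G\otimes G$ is the group generated by symbols $g\otimes h$ ($g,h\in G$) subject to the relations $gg'\otimes h=(g^{g'}\otimes h^{g'})(g'\otimes h)$ and $g\otimes hh'=(g\otimes h')(g^{h'}\otimes h^{h'})$ for all $g,g',h,h'\in G$; its identity is $1_\otimes$. $A^\otimes(G)$ is the set of tensor commuting automorphisms of $G$: those $\alpha\in \mathrm{Aut}(G)$ with $x\otimes\alpha(x)=1_\otimes$ for all $x\in G$. $R_2^\otimes(G)=\{g\in G : [g,x]\otimes x=1_\otimes \text{ for all } x\in G\}$ (the right $2_\otimes$-Engel elements). *)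

theory Defs
  imports "HOL-Algebra.Bij"
begin

text \<open>A word over a set \<open>X\<close> of generators is a list of letters; the letter \<open>(x, True)\<close>
  stands for \<open>x\<close> and \<open>(x, False)\<close> for the inverse of \<open>x\<close>.\<close>

type_synonym 'x word = "('x \<times> bool) list"

definition words :: "'x set \<Rightarrow> 'x word set"
  where "words X = lists (X \<times> UNIV)"

text \<open>The least congruence on words that contains the relators \<open>u = v\<close> for \<open>(u, v) \<in> R\<close> and
  the free cancellations.\<close>

inductive pres_eq :: "'x set \<Rightarrow> ('x word \<times> 'x word) set \<Rightarrow> 'x word \<Rightarrow> 'x word \<Rightarrow> bool"
  for X R where
  pres_refl: "u \<in> words X \<Longrightarrow> pres_eq X R u u"
| pres_sym: "pres_eq X R u v \<Longrightarrow> pres_eq X R v u"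
| pres_trans: "pres_eq X R u v \<Longrightarrow> pres_eq X R v w \<Longrightarrow> pres_eq X R u w"
| pres_append: "pres_eq X R u u' \<Longrightarrow> pres_eq X R v v' \<Longrightarrow> pres_eq X R (u @ v) (u' @ v')"
| pres_cancel: "x \<in> X \<Longrightarrow> pres_eq X R [(x, b), (x, \<not> b)] []"
| pres_rel: "(u, v) \<in> R \<Longrightarrow> u \<in> words X \<Longrightarrow> v \<in> words X \<Longrightarrow> pres_eq X R u v"

definition pres_class :: "'x set \<Rightarrow> ('x word \<times> 'x word) set \<Rightarrow> 'x word \<Rightarrow> 'x word set"
  where "pres_class X R u = {v. pres_eq X R u v}"

definition presented_group :: "'x set \<Rightarrow> ('x word \<times> 'x word) set \<Rightarrow> 'x word set monoid"
  where "presented_group X R =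
    \<lparr>carrier = pres_class X R ` words X,
     mult = (\<lambda>A B. \<Union>u\<in>A. \<Union>v\<in>B. pres_class X R (u @ v)),
     one = pres_class X R []\<rparr>"

lemma words_simps [simp]:
  "[] \<in> words X" "u @ v \<in> words X \<longleftrightarrow> u \<in> words X \<and> v \<in> words X"
  "(x, b) # u \<in> words X \<longleftrightarrow> x \<in> X \<and> u \<in> words X"
  by (auto simp: words_def)

lemma pres_eq_words: "pres_eq X R u v \<Longrightarrow> u \<in> words X \<and> v \<in> words X"
  by (induction rule: pres_eq.induct) auto

lemma pres_class_eq_iff:
  assumes "u \<in> words X"
  shows "pres_class X R u = pres_class X R v \<longleftrightarrow> pres_eq X R u v"
  using assms unfolding pres_class_def by (blast intro: pres_eq.intros)

lemma presented_group_mult: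
  assumes "u \<in> words X" "v \<in> words X"
  shows "pres_class X R u \<otimes>\<^bsub>presented_group X R\<^esub> pres_class X R v = pres_class X R (u @ v)"
  using assms unfolding presented_group_def pres_class_def
  by simp (blast intro: pres_eq.intros)

lemma pres_inverse:
  assumes "u \<in> words X"
  shows "\<exists>v\<in>words X. pres_eq X R (v @ u) []"
  using assms
proof (induction u)
  case Nil
  then show ?case by (auto intro!: bexI[of _ "[]"] pres_refl)
next
  case (Cons a u)
  obtain x b where a: "a = (x, b)" by (cases a)
  with Cons obtain v where x: "x \<in> X" and u: "u \<in> words X" and v: "v \<in> words X"
    and vu: "pres_eq X R (v @ u) []" by auto
  have "pres_eq X R [(x, \<not> b), (x, b)] []"
    using pres_cancel[OF x, of R "\<not> b"] by simp
  then have "pres_eq X R ((v @ [(x, \<not> b), (x, b)]) @ u) ((v @ []) @ u)"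
    using u v by (intro pres_append pres_refl)
  then have "pres_eq X R ((v @ [(x, \<not> b)]) @ (a # u)) []"
    using vu a by (auto intro: pres_trans)
  then show ?case using v x by (intro bexI[of _ "v @ [(x, \<not> b)]"]) auto
qed

lemma group_presented_group: "group (presented_group X R)"
proof (rule groupI)
  note [simp] = presented_group_mult
  have c: "carrier (presented_group X R) = pres_class X R ` words X"
    and o: "\<one>\<^bsub>presented_group X R\<^esub> = pres_class X R []"
    by (simp_all add: presented_group_def)
  show "x \<otimes>\<^bsub>presented_group X R\<^esub> y \<in> carrier (presented_group X R)"
    if "x \<in> carrier (presented_group X R)" "y \<in> carrier (presented_group X R)" for x y
    using that by (auto simp: c)
  show "\<one>\<^bsub>presented_group X R\<^esub> \<in> carrier (presented_group X R)" by (auto simp: c o)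
  show "x \<otimes>\<^bsub>presented_group X R\<^esub> y \<otimes>\<^bsub>presented_group X R\<^esub> z =
      x \<otimes>\<^bsub>presented_group X R\<^esub> (y \<otimes>\<^bsub>presented_group X R\<^esub> z)"
    if "x \<in> carrier (presented_group X R)" "y \<in> carrier (presented_group X R)"
      "z \<in> carrier (presented_group X R)" for x y z
    using that by (auto simp: c)
  show "\<one>\<^bsub>presented_group X R\<^esub> \<otimes>\<^bsub>presented_group X R\<^esub> x = x"
    if "x \<in> carrier (presented_group X R)" for x
    using that by (auto simp: c o)
  show "\<exists>y\<in>carrier (presented_group X R). y \<otimes>\<^bsub>presented_group X R\<^esub> x = \<one>\<^bsub>presented_group X R\<^esub>"
    if x: "x \<in> carrier (presented_group X R)" for x
  proof -
    from x obtain u where u: "u \<in> words X" "x = pres_class X R u" by (auto simp: c)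
    from pres_inverse[OF this(1)] obtain v where v: "v \<in> words X" "pres_eq X R (v @ u) []" by blast
    with u show ?thesis
      by (intro bexI[of _ "pres_class X R v"]) (auto simp: c o pres_class_eq_iff)
  qed
qed


definition conjugate :: "('a, 'b) monoid_scheme \<Rightarrow> 'a \<Rightarrow> 'a \<Rightarrow> 'a"
  where "conjugate G g h = inv\<^bsub>G\<^esub> h \<otimes>\<^bsub>G\<^esub> g \<otimes>\<^bsub>G\<^esub> h"

definition commutator :: "('a, 'b) monoid_scheme \<Rightarrow> 'a \<Rightarrow> 'a \<Rightarrow> 'a"
  where "commutator G g h = inv\<^bsub>G\<^esub> g \<otimes>\<^bsub>G\<^esub> inv\<^bsub>G\<^esub> h \<otimes>\<^bsub>G\<^esub> g \<otimes>\<^bsub>G\<^esub> h"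

definition tensor_relators :: "('a, 'b) monoid_scheme \<Rightarrow> (('a \<times> 'a) word \<times> ('a \<times> 'a) word) set"
  where "tensor_relators G =
    {([((g \<otimes>\<^bsub>G\<^esub> g', h), True)], [((conjugate G g g', conjugate G h g'), True), ((g', h), True)])
      | g g' h. g \<in> carrier G \<and> g' \<in> carrier G \<and> h \<in> carrier G} \<union>
    {([((g, h \<otimes>\<^bsub>G\<^esub> h'), True)], [((g, h'), True), ((conjugate G g h', conjugate G h h'), True)])
      | g h h'. g \<in> carrier G \<and> h \<in> carrier G \<and> h' \<in> carrier G}"

definition tensor_square :: "('a, 'b) monoid_scheme \<Rightarrow> ('a \<times> 'a) word set monoid"
  where "tensor_square G = presented_group (carrier G \<times> carrier G) (tensor_relators G)"

definition tensor :: "('a, 'b) monoid_scheme \<Rightarrow> 'a \<Rightarrow> 'a \<Rightarrow> ('a \<times> 'a) word set"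
  where "tensor G g h = pres_class (carrier G \<times> carrier G) (tensor_relators G) [((g, h), True)]"

lemma group_tensor_square: "group (tensor_square G)"
  unfolding tensor_square_def by (rule group_presented_group)

lemma tensor_closed:
  "g \<in> carrier G \<Longrightarrow> h \<in> carrier G \<Longrightarrow> tensor G g h \<in> carrier (tensor_square G)"
  unfolding tensor_def tensor_square_def presented_group_def by auto

lemma (in group) conjugate_closed:
  "g \<in> carrier G \<Longrightarrow> h \<in> carrier G \<Longrightarrow> conjugate G g h \<in> carrier G"
  by (simp add: conjugate_def)

lemma (in group) tensor_mult_left:
  assumes "g \<in> carrier G" "g' \<in> carrier G" "h \<in> carrier G"
  shows "tensor G (g \<otimes> g') h =
    tensor G (conjugate G g g') (conjugate G h g') \<otimes>\<^bsub>tensor_square G\<^esub> tensor G g' h"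
proof -
  have "pres_eq (carrier G \<times> carrier G) (tensor_relators G) [((g \<otimes> g', h), True)]
      [((conjugate G g g', conjugate G h g'), True), ((g', h), True)]"
    using assms by (intro pres_rel) (auto simp: tensor_relators_def conjugate_closed)
  then show ?thesis
    using assms unfolding tensor_def tensor_square_def
    by (simp add: presented_group_mult pres_class_eq_iff conjugate_closed)
qed

lemma (in group) tensor_mult_right:
  assumes "g \<in> carrier G" "h \<in> carrier G" "h' \<in> carrier G"
  shows "tensor G g (h \<otimes> h') =
    tensor G g h' \<otimes>\<^bsub>tensor_square G\<^esub> tensor G (conjugate G g h') (conjugate G h h')"
proof -
  have "pres_eq (carrier G \<times> carrier G) (tensor_relators G) [((g, h \<otimes> h'), True)]
      [((g, h'), True), ((conjugate G g h', conjugate G h h'), True)]"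
    using assms by (intro pres_rel) (auto simp: tensor_relators_def conjugate_closed)
  then show ?thesis
    using assms unfolding tensor_def tensor_square_def
    by (simp add: presented_group_mult pres_class_eq_iff conjugate_closed)
qed


text \<open>As in the library's \<^const>\<open>auto\<close>, automorphisms are extensional functions, so that equal
  automorphisms are equal as functions on the whole type.\<close>

definition inner_automorphism :: "('a, 'b) monoid_scheme \<Rightarrow> 'a \<Rightarrow> 'a \<Rightarrow> 'a"
  where "inner_automorphism G g = (\<lambda>x\<in>carrier G. conjugate G x g)"

definition tensor_commuting_automorphisms :: "('a, 'b) monoid_scheme \<Rightarrow> ('a \<Rightarrow> 'a) set"
  where "tensor_commuting_automorphisms G =
    {\<alpha> \<in> auto G. \<forall>x\<in>carrier G. tensor G x (\<alpha> x) = \<one>\<^bsub>tensor_square G\<^esub>}"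

definition right_2_tensor_Engel :: "('a, 'b) monoid_scheme \<Rightarrow> 'a set"
  where "right_2_tensor_Engel G =
    {g \<in> carrier G. \<forall>x\<in>carrier G. tensor G (commutator G g x) x = \<one>\<^bsub>tensor_square G\<^esub>}"

end

theory Submission
  imports Defs
begin

text \<open>Expanding \<open>xy \<otimes> xy = 1\<close> shows that \<open>a \<otimes> b\<close> and \<open>b \<otimes> a\<close> are mutually
  inverse. Since \<open>[g,x] = (x\<inverse>)\<^sup>g x\<close>, the left relation and \<open>x \<otimes> x = 1\<close> give
  \<open>[g,x] \<otimes> x = ((x\<inverse>)\<^sup>g)\<^sup>x \<otimes> x\<close>. As \<open>G\<close> acts diagonally on its tensor square, this vanishes
  iff \<open>(x\<^sup>g)\<inverse> \<otimes> x\<close> does, hence iff \<open>x\<^sup>g \<otimes> x\<close> does, hence iff \<open>x \<otimes> x\<^sup>g\<close> does.\<close>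

lemma map_words:
  assumes "u \<in> words X" and "\<And>x. x \<in> X \<Longrightarrow> f x \<in> Y"
  shows "map (map_prod f id) u \<in> words Y"
  using assms(1) by (induction u) (auto simp: assms(2))

text \<open>Von Dyck's theorem on the level of words: a map of generators that turns relators into
  consequences of the target relations induces a homomorphism of the presented groups. Here it
  supplies the diagonal action of \<open>G\<close> on its tensor square.\<close>

lemma pres_eq_map:
  assumes "pres_eq X R u v"
    and "\<And>x. x \<in> X \<Longrightarrow> f x \<in> Y"
    and "\<And>u v. (u, v) \<in> R \<Longrightarrow> u \<in> words X \<Longrightarrow> v \<in> words X \<Longrightarrow>
      pres_eq Y S (map (map_prod f id) u) (map (map_prod f id) v)"
  shows "pres_eq Y S (map (map_prod f id) u) (map (map_prod f id) v)"
  using assms(1)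
proof (induction rule: pres_eq.induct)
  case (pres_refl u)
  then show ?case by (intro pres_eq.pres_refl map_words assms(2))
next
  case (pres_cancel x b)
  then show ?case using pres_eq.pres_cancel[of "f x" Y S b] by (simp add: assms(2))
next
  case (pres_rel u v)
  then show ?case by (rule assms(3))
qed (auto intro: pres_eq.intros)

context group
begin

lemma inv_mult_cancel_left [simp]:
  assumes "x \<in> carrier G" "y \<in> carrier G"
  shows "inv x \<otimes> (x \<otimes> y) = y" "x \<otimes> (inv x \<otimes> y) = y"
  using assms by (simp_all add: m_assoc[symmetric])

lemma conjugate_mult:
  "x \<in> carrier G \<Longrightarrow> y \<in> carrier G \<Longrightarrow> k \<in> carrier G \<Longrightarrow>
    conjugate G (x \<otimes> y) k = conjugate G x k \<otimes> conjugate G y k"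
  by (simp add: conjugate_def m_assoc)

lemma conjugate_conjugate:
  "x \<in> carrier G \<Longrightarrow> h \<in> carrier G \<Longrightarrow> k \<in> carrier G \<Longrightarrow>
    conjugate G (conjugate G x h) k = conjugate G x (h \<otimes> k)"
  by (simp add: conjugate_def m_assoc inv_mult_group)

text \<open>Holds because hk = k(k\<inverse>hk). It is what makes conjugation by k carry defining
  relators of the tensor square to defining relators.\<close>

lemma conjugate_conjugate_swap:
  "x \<in> carrier G \<Longrightarrow> h \<in> carrier G \<Longrightarrow> k \<in> carrier G \<Longrightarrow>
    conjugate G (conjugate G x h) k = conjugate G (conjugate G x k) (conjugate G h k)"
  by (simp add: conjugate_def m_assoc inv_mult_group)

lemma conjugate_self [simp]: "x \<in> carrier G \<Longrightarrow> conjugate G x x = x"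
  by (simp add: conjugate_def m_assoc)

lemma conjugate_by_one [simp]: "x \<in> carrier G \<Longrightarrow> conjugate G x \<one> = x"
  by (simp add: conjugate_def)

lemma conjugate_inv:
  "x \<in> carrier G \<Longrightarrow> k \<in> carrier G \<Longrightarrow> conjugate G (inv x) k = inv (conjugate G x k)"
  by (simp add: conjugate_def m_assoc inv_mult_group)

lemma inner_automorphism_in_auto:
  assumes g: "g \<in> carrier G"
  shows "inner_automorphism G g \<in> auto G"
proof -
  have "bij_betw (inner_automorphism G g) (carrier G) (carrier G)"
    \<comment> \<open>The inverse map is conjugation by \<open>inv g\<close>.\<close>
    by (rule bij_betwI[where g = "\<lambda>x. conjugate G x (inv g)"])
      (auto simp: inner_automorphism_def conjugate_closed conjugate_conjugate g)
  then show ?thesis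
    using g by (auto simp: auto_def hom_def Bij_def inner_automorphism_def conjugate_closed
        conjugate_mult)
qed

text \<open>Moves vanishing from classes to words, where \<open>pres_eq_map\<close> applies.\<close>

lemma tensor_eq_one_iff:
  assumes "a \<in> carrier G" "b \<in> carrier G"
  shows "tensor G a b = \<one>\<^bsub>tensor_square G\<^esub> \<longleftrightarrow>
    pres_eq (carrier G \<times> carrier G) (tensor_relators G) [((a, b), True)] []"
  using assms unfolding tensor_def tensor_square_def presented_group_def
  by (simp add: pres_class_eq_iff)

lemma tensor_one_conjugate:
  assumes k: "k \<in> carrier G" and ab: "a \<in> carrier G" "b \<in> carrier G"
    and one: "tensor G a b = \<one>\<^bsub>tensor_square G\<^esub>"
  shows "tensor G (conjugate G a k) (conjugate G b k) = \<one>\<^bsub>tensor_square G\<^esub>"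
proof -
  let ?X = "carrier G \<times> carrier G" and ?R = "tensor_relators G"
  let ?f = "\<lambda>(a, b). (conjugate G a k, conjugate G b k)"
  have "pres_eq ?X ?R (map (map_prod ?f id) [((a, b), True)]) (map (map_prod ?f id) [])"
  proof (rule pres_eq_map)
    show "pres_eq ?X ?R [((a, b), True)] []"
      using one ab by (simp add: tensor_eq_one_iff)
    show f: "?f x \<in> ?X" if "x \<in> ?X" for x
      using that k by (auto simp: conjugate_closed)
    fix u v assume uv: "(u, v) \<in> ?R" "u \<in> words ?X" "v \<in> words ?X"
    have w: "map (map_prod ?f id) w \<in> words ?X" if "w \<in> words ?X" for w
      using that f by (rule map_words)
    \<comment> \<open>The image of a relator is the relator of the same kind for the three
      conjugated parameters.\<close>
    have "(map (map_prod ?f id) u, map (map_prod ?f id) v) \<in> ?R"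
      using uv(1) k unfolding tensor_relators_def
    proof (elim UnE CollectE exE conjE, goal_cases)
      case (1 x x' h)
      then show ?case
        by (intro UnI1 CollectI exI[of _ "conjugate G x k"] exI[of _ "conjugate G x' k"]
            exI[of _ "conjugate G h k"])
          (simp add: conjugate_closed conjugate_mult conjugate_conjugate_swap[of _ x' k])
    next
      case (2 x h h')
      then show ?case
        by (intro UnI2 CollectI exI[of _ "conjugate G x k"] exI[of _ "conjugate G h k"]
            exI[of _ "conjugate G h' k"])
          (simp add: conjugate_closed conjugate_mult conjugate_conjugate_swap[of _ h' k])
    qed
    then show "pres_eq ?X ?R (map (map_prod ?f id) u) (map (map_prod ?f id) v)"
      using uv w by (intro pres_rel)
  qed
  then show ?thesis
    using ab k by (simp add: tensor_eq_one_iff conjugate_closed)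
qed

lemma tensor_one_conjugate_iff:
  assumes "k \<in> carrier G" "a \<in> carrier G" "b \<in> carrier G"
  shows "tensor G (conjugate G a k) (conjugate G b k) = \<one>\<^bsub>tensor_square G\<^esub> \<longleftrightarrow>
    tensor G a b = \<one>\<^bsub>tensor_square G\<^esub>"
  \<comment> \<open>Conjugating back by \<open>inv k\<close> gives the converse.\<close>
  using tensor_one_conjugate[of "inv k" "conjugate G a k" "conjugate G b k"]
    tensor_one_conjugate[of k a b] assms
  by (auto simp: conjugate_closed conjugate_conjugate)

text \<open>Splitting 1 = 1 1 on the left makes this tensor idempotent, because conjugation by 1 is
  trivial.\<close>

lemma tensor_one_left:
  assumes "x \<in> carrier G"
  shows "tensor G \<one> x = \<one>\<^bsub>tensor_square G\<^esub>"
proof -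
  interpret T: group "tensor_square G" by (rule group_tensor_square)
  have "tensor G \<one> x = tensor G \<one> x \<otimes>\<^bsub>tensor_square G\<^esub> tensor G \<one> x"
    using tensor_mult_left[of \<one> \<one> x] assms by simp
  then show ?thesis
    using assms by (simp add: tensor_closed T.l_cancel_one')
qed

lemma tensor_inv_left:
  assumes y: "y \<in> carrier G" and x: "x \<in> carrier G"
    and one: "tensor G y x = \<one>\<^bsub>tensor_square G\<^esub>"
  shows "tensor G (inv y) x = \<one>\<^bsub>tensor_square G\<^esub>"
proof -
  interpret T: group "tensor_square G" by (rule group_tensor_square)
  have iy: "conjugate G (inv y) y = inv y"
    using y by (simp add: conjugate_inv)
  have "\<one>\<^bsub>tensor_square G\<^esub> = tensor G (inv y \<otimes> y) x"
    using x y by (simp add: tensor_one_left)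
  \<comment> \<open>The left relation leaves a second factor \<open>tensor G y x\<close>, which is
    trivial by assumption; the remaining factor is a conjugate of the wanted tensor.\<close>
  also have "\<dots> = tensor G (conjugate G (inv y) y) (conjugate G x y)"
    using tensor_mult_left[of "inv y" y x] x y one by (simp add: tensor_closed conjugate_closed)
  finally show ?thesis
    using tensor_one_conjugate_iff[of y "inv y" x] x y by simp
qed

lemma tensor_one_sym:
  assumes alt: "\<And>x. x \<in> carrier G \<Longrightarrow> tensor G x x = \<one>\<^bsub>tensor_square G\<^esub>"
    and a: "a \<in> carrier G" and y: "y \<in> carrier G"
    and one: "tensor G a y = \<one>\<^bsub>tensor_square G\<^esub>"
  shows "tensor G y a = \<one>\<^bsub>tensor_square G\<^esub>"
proof -
  interpret T: group "tensor_square G" by (rule group_tensor_square)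
  \<comment> \<open>Chosen so that conjugating x by y yields a: the relations applied to xy
    \<otimes> xy then produce a itself.\<close>
  define x where "x = conjugate G a (inv y)"
  have x: "x \<in> carrier G" and xy: "conjugate G x y = a"
    using a y by (simp_all add: x_def conjugate_closed conjugate_conjugate)
  have "\<one>\<^bsub>tensor_square G\<^esub> = tensor G (x \<otimes> y) (x \<otimes> y)"
    using alt x y by simp
  also have "\<dots> = tensor G a (a \<otimes> y) \<otimes>\<^bsub>tensor_square G\<^esub> tensor G y (x \<otimes> y)"
    using tensor_mult_left[of x y "x \<otimes> y"] x y xy by (simp add: conjugate_mult)
  \<comment> \<open>The right relation gives a \<otimes> y, trivial by assumption, times the tensor
    of a conjugate of a with itself.\<close>
  also have "tensor G a (a \<otimes> y) = \<one>\<^bsub>tensor_square G\<^esub>"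
    using tensor_mult_right[of a a y] a y alt one by (simp add: conjugate_closed)
  also have "tensor G y (x \<otimes> y) = tensor G y a"
    using tensor_mult_right[of y x y] x y a xy alt by (simp add: tensor_closed)
  finally show ?thesis
    using a y by (simp add: tensor_closed)
qed

text \<open>The theorem for a single x: the Engel condition at x against the commuting condition at
  x.\<close>

lemma tensor_commutator_one_iff:
  assumes alt: "\<And>x. x \<in> carrier G \<Longrightarrow> tensor G x x = \<one>\<^bsub>tensor_square G\<^esub>"
    and g: "g \<in> carrier G" and x: "x \<in> carrier G"
  shows "tensor G (commutator G g x) x = \<one>\<^bsub>tensor_square G\<^esub> \<longleftrightarrow>
    tensor G x (conjugate G x g) = \<one>\<^bsub>tensor_square G\<^esub>"
proof -
  interpret T: group "tensor_square G" by (rule group_tensor_square)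
  let ?y = "conjugate G x g"
  have y: "?y \<in> carrier G"
    using g x by (rule_tac conjugate_closed)
  have "commutator G g x = inv ?y \<otimes> x"
    using g x by (simp add: commutator_def conjugate_def m_assoc inv_mult_group)
  then have "tensor G (commutator G g x) x = tensor G (conjugate G (inv ?y) x) (conjugate G x x)"
    using tensor_mult_left[of "inv ?y" x x] x y alt by (simp add: tensor_closed conjugate_closed)
  then have "tensor G (commutator G g x) x = \<one>\<^bsub>tensor_square G\<^esub> \<longleftrightarrow>
      tensor G (inv ?y) x = \<one>\<^bsub>tensor_square G\<^esub>"
    using tensor_one_conjugate_iff[of x "inv ?y" x] x y by simp
  also have "\<dots> \<longleftrightarrow> tensor G ?y x = \<one>\<^bsub>tensor_square G\<^esub>"
    \<comment> \<open>Inversion is an involution, so the one-way lemma gives both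
      directions.\<close>
    using tensor_inv_left[of ?y x] tensor_inv_left[of "inv ?y" x] x y by auto
  also have "\<dots> \<longleftrightarrow> tensor G x ?y = \<one>\<^bsub>tensor_square G\<^esub>"
    using tensor_one_sym[OF alt] x y by blast
  finally show ?thesis .
qed

end

theorem theorem2p5:
  fixes G (structure) and g :: 'a
  assumes "group G"
    and "\<And>x. x \<in> carrier G \<Longrightarrow> tensor G x x = \<one>\<^bsub>tensor_square G\<^esub>"
    and "g \<in> carrier G"
  shows "inner_automorphism G g \<in> tensor_commuting_automorphisms G \<longleftrightarrow> g \<in> right_2_tensor_Engel G"
proof -
  interpret group G by fact
  show ?thesis
    \<comment> \<open>Membership in \<open>auto G\<close> and in the carrier is settled, so only the
      conditions for each x remain to be compared.\<close>
    using inner_automorphism_in_auto[OF assms(3)] tensor_commutator_one_iff[OF assms(2,3)] assms(3)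
    by (simp add: tensor_commuting_automorphisms_def right_2_tensor_Engel_def
        inner_automorphism_def)
qed

end
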